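(* Let $\{X_k\}_{k=0}^{N-1}$ be square random matrices and $\{y_k\}_{k=0}^{N-1}$ random vectors of compatible dimension, both with bounded second moments, and let $\{F_k\}_{k=0}^{N-1}$ be deterministic matrices of compatible dimensions. Suppose that $(X_k,y_k)$ may be dependent, but $X_k$ and $X_l$ are independent for $k\neq l$. Then $$\mathbb E\Big[\Big\|\sum_{k=0}^{N-1}F_kX_ky_k\Big\|^2\Big]\le\sum_{k=0}^{N-1}\|F_k\|^2\sqrt{\mathbb E[\|X_k\|^4]}\;\sqrt{\mathbb E\Big[\Big(\sum_{k=0}^{N-1}\|y_k\|^2\Big)^2\Big]}.$$
   Context: $\|\cdot\|$ denotes the Euclidean norm for vectors and the spectral norm for matrices. *)

theory Defs
  imports "HOL-Probability.Probability"
begin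

text \<open>Spectral (operator) norm of a matrix, w.r.t. Euclidean norms.
  Note: the library's norm on real^'n^'m is the Frobenius norm, hence this definition.\<close>
definition specnorm :: "real^'n^'m \<Rightarrow> real" where
  "specnorm A = onorm (\<lambda>x. A *v x)"

definition esqrt :: "ennreal \<Rightarrow> ennreal" where
  "esqrt x = (if x = \<infinity> then \<infinity> else ennreal (sqrt (enn2real x)))"

end

theory Submission
  imports Defs
begin

text \<open>The bound holds for any measure, without independence or finite moments.
  Pointwise, the triangle inequality and the discrete Cauchy--Schwarz inequality give
  \<open>\<parallel>\<Sum>k. F\<^sub>k X\<^sub>k y\<^sub>k\<parallel>\<^sup>2 \<le> (\<Sum>k. \<parallel>F\<^sub>k\<parallel>\<^sup>2 \<parallel>X\<^sub>k\<parallel>\<^sup>2) (\<Sum>k. \<parallel>y\<^sub>k\<parallel>\<^sup>2)\<close>;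
  integrating and applying the Cauchy--Schwarz inequality for integrals to each product
  \<open>\<parallel>X\<^sub>k\<parallel>\<^sup>2 \<cdot> \<Sum>j. \<parallel>y\<^sub>j\<parallel>\<^sup>2\<close> finishes the proof. Working with nonnegative integrals and
  \<open>esqrt\<close> keeps every step valid when some moment is infinite.\<close>

lemma norm_mult_vec_le_specnorm: "norm (A *v x) \<le> specnorm A * norm x"
  unfolding specnorm_def by (rule onorm) simp

lemma specnorm_nonneg: "0 \<le> specnorm A"
  unfolding specnorm_def by (rule onorm_pos_le) simp

lemma specnorm_le_norm: "specnorm (A::real^'n^'m) \<le> real CARD('m) * real CARD('n) * norm A"
  unfolding specnorm_def
proof (rule onorm_le_matrix_component)
  fix i j
  have "\<bar>A $ i $ j\<bar> \<le> norm (A $ i)" by (rule component_le_norm_cart)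
  also have "\<dots> \<le> norm A" by (rule Finite_Cartesian_Product.norm_nth_le)
  finally show "\<bar>A $ i $ j\<bar> \<le> norm A" .
qed

lemma specnorm_triangle: "specnorm (A + B) \<le> specnorm A + specnorm B"
  unfolding specnorm_def matrix_vector_mult_add_rdistrib by (rule onorm_triangle) simp_all

lemma specnorm_minus_commute: "specnorm (A - B) = specnorm (B - A)"
proof -
  have "(\<lambda>x. (A - B) *v x) = (\<lambda>x. - ((B - A) *v x))"
    by (simp add: matrix_vector_mult_diff_rdistrib)
  then show ?thesis
    unfolding specnorm_def by (simp add: onorm_neg)
qed

lemma abs_specnorm_diff_le: "\<bar>specnorm A - specnorm B\<bar> \<le> specnorm (A - B)"
  using specnorm_triangle[of "A - B" B] specnorm_triangle[of "B - A" A]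
  by (simp add: abs_le_iff specnorm_minus_commute[of B A])

lemma continuous_on_specnorm: "continuous_on UNIV (specnorm :: real^'n^'m \<Rightarrow> real)"
proof (rule lipschitz_on_continuous_on)
  show "(real CARD('m) * real CARD('n))-lipschitz_on UNIV (specnorm :: real^'n^'m \<Rightarrow> real)"
  proof (rule lipschitz_onI)
    fix A B :: "real^'n^'m"
    show "dist (specnorm A) (specnorm B) \<le> real CARD('m) * real CARD('n) * dist A B"
      using abs_specnorm_diff_le[of A B] specnorm_le_norm[of "A - B"]
      by (simp add: dist_real_def dist_norm)
  qed simp
qed

lemma borel_measurable_specnorm[measurable]:
  "specnorm \<in> borel_measurable (borel :: (real^'n^'m) measure)"
  by (rule borel_measurable_continuous_onI[OF continuous_on_specnorm])

lemma norm_sum_mult_vec_sq_le: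
  fixes F :: "'i \<Rightarrow> real^'n^'m" and X :: "'i \<Rightarrow> real^'n^'n" and y :: "'i \<Rightarrow> real^'n"
  shows "(norm (\<Sum>k\<in>I. F k *v (X k *v y k)))^2
     \<le> (\<Sum>k\<in>I. (specnorm (F k))^2 * (specnorm (X k))^2) * (\<Sum>k\<in>I. (norm (y k))^2)"
proof -
  have "norm (\<Sum>k\<in>I. F k *v (X k *v y k)) \<le> (\<Sum>k\<in>I. norm (F k *v (X k *v y k)))"
    by (rule norm_sum)
  also have "\<dots> \<le> (\<Sum>k\<in>I. (specnorm (F k) * specnorm (X k)) * norm (y k))"
  proof (rule sum_mono)
    fix k
    have "norm (F k *v (X k *v y k)) \<le> specnorm (F k) * norm (X k *v y k)"
      by (rule norm_mult_vec_le_specnorm)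
    also have "\<dots> \<le> specnorm (F k) * (specnorm (X k) * norm (y k))"
      by (rule mult_left_mono[OF norm_mult_vec_le_specnorm specnorm_nonneg])
    finally show "norm (F k *v (X k *v y k)) \<le> (specnorm (F k) * specnorm (X k)) * norm (y k)"
      by (simp add: mult.assoc)
  qed
  finally have "(norm (\<Sum>k\<in>I. F k *v (X k *v y k)))^2
      \<le> (\<Sum>k\<in>I. (specnorm (F k) * specnorm (X k)) * norm (y k))^2"
    by (rule power_mono) simp
  also have "\<dots> \<le> (\<Sum>k\<in>I. (specnorm (F k) * specnorm (X k))^2) * (\<Sum>k\<in>I. (norm (y k))^2)"
    by (rule Cauchy_Schwarz_ineq_sum)
  finally show ?thesis by (simp add: power_mult_distrib)
qed

lemma ennreal_power2_le_imp_le: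
  fixes x y :: ennreal
  assumes "x ^ 2 \<le> y ^ 2"
  shows "x \<le> y"
proof (cases y)
  case (real b)
  moreover from this assms obtain a where "x = ennreal a" "0 \<le> a"
    by (cases x) (auto simp: ennreal_power top_unique)
  ultimately show ?thesis
    using assms by (auto simp: ennreal_power intro!: ennreal_leI power2_le_imp_le)
qed simp

lemma esqrt_power2: "esqrt A ^ 2 = A"
  by (cases A) (simp_all add: esqrt_def ennreal_power)

lemma le_esqrt_mult_esqrt:
  fixes x :: ennreal
  assumes "x ^ 2 \<le> A * B"
  shows "x \<le> esqrt A * esqrt B"
  by (rule ennreal_power2_le_imp_le) (simp only: power_mult_distrib esqrt_power2 assms)

lemma nn_integral_mult_le_esqrt:
  assumes "f \<in> borel_measurable M" "g \<in> borel_measurable M"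
  shows "(\<integral>\<^sup>+x. f x * g x \<partial>M) \<le> esqrt (\<integral>\<^sup>+x. f x ^ 2 \<partial>M) * esqrt (\<integral>\<^sup>+x. g x ^ 2 \<partial>M)"
  by (rule le_esqrt_mult_esqrt[OF Cauchy_Schwarz_nn_integral[OF assms]])

lemma nn_integral_sum_mult_le_esqrt:
  fixes g :: "'i \<Rightarrow> 'a \<Rightarrow> ennreal" and h :: "'a \<Rightarrow> ennreal"
  assumes "finite I" and [measurable]: "\<And>k. k \<in> I \<Longrightarrow> g k \<in> borel_measurable M"
    and [measurable]: "h \<in> borel_measurable M"
  shows "(\<integral>\<^sup>+x. (\<Sum>k\<in>I. c k * g k x) * h x \<partial>M)
    \<le> (\<Sum>k\<in>I. c k * esqrt (\<integral>\<^sup>+x. g k x ^ 2 \<partial>M)) * esqrt (\<integral>\<^sup>+x. h x ^ 2 \<partial>M)"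
proof -
  have "(\<integral>\<^sup>+x. (\<Sum>k\<in>I. c k * g k x) * h x \<partial>M) = (\<Sum>k\<in>I. c k * (\<integral>\<^sup>+x. g k x * h x \<partial>M))"
    using assms(1) by (simp add: sum_distrib_right mult.assoc nn_integral_sum nn_integral_cmult)
  also have "\<dots> \<le> (\<Sum>k\<in>I. c k * (esqrt (\<integral>\<^sup>+x. g k x ^ 2 \<partial>M) * esqrt (\<integral>\<^sup>+x. h x ^ 2 \<partial>M)))"
    by (intro sum_mono mult_left_mono nn_integral_mult_le_esqrt) simp_all
  finally show ?thesis
    by (simp add: sum_distrib_right mult.assoc)
qed

theorem lemma4:
  fixes M :: "'a measure" and N :: nat
    and X :: "nat \<Rightarrow> 'a \<Rightarrow> real^'n^'n"
    and y :: "nat \<Rightarrow> 'a \<Rightarrow> real^'n"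
    and F :: "nat \<Rightarrow> real^'n^'m"
  assumes "prob_space M"
    and "\<And>k. k < N \<Longrightarrow> X k \<in> borel_measurable M"
    and "\<And>k. k < N \<Longrightarrow> y k \<in> borel_measurable M"
    and "\<And>k. k < N \<Longrightarrow> integrable M (\<lambda>\<omega>. (specnorm (X k \<omega>))^2)"
    and "\<And>k. k < N \<Longrightarrow> integrable M (\<lambda>\<omega>. (norm (y k \<omega>))^2)"
    and "prob_space.indep_vars M (\<lambda>_. borel) X {..<N}"
  shows "(\<integral>\<^sup>+\<omega>. ennreal ((norm (\<Sum>k<N. F k *v (X k \<omega> *v y k \<omega>)))^2) \<partial>M)
    \<le> (\<Sum>k<N. ennreal ((specnorm (F k))^2) *
                esqrt (\<integral>\<^sup>+\<omega>. ennreal ((specnorm (X k \<omega>))^4) \<partial>M))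
       * esqrt (\<integral>\<^sup>+\<omega>. ennreal ((\<Sum>k<N. (norm (y k \<omega>))^2)^2) \<partial>M)"
proof -
  define S where "S \<omega> = (\<Sum>k<N. (norm (y k \<omega>))^2)" for \<omega>
  have S_nonneg: "0 \<le> S \<omega>" for \<omega>
    unfolding S_def by (simp add: sum_nonneg)
  have pointwise: "ennreal ((norm (\<Sum>k<N. F k *v (X k \<omega> *v y k \<omega>)))^2)
      \<le> (\<Sum>k<N. ennreal ((specnorm (F k))^2) * ennreal ((specnorm (X k \<omega>))^2)) * ennreal (S \<omega>)" for \<omega>
  proof -
    have "ennreal ((norm (\<Sum>k<N. F k *v (X k \<omega> *v y k \<omega>)))^2)
        \<le> ennreal ((\<Sum>k<N. (specnorm (F k))^2 * (specnorm (X k \<omega>))^2) * S \<omega>)"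
      unfolding S_def by (rule ennreal_leI[OF norm_sum_mult_vec_sq_le])
    also have "\<dots> = (\<Sum>k<N. ennreal ((specnorm (F k))^2) * ennreal ((specnorm (X k \<omega>))^2)) * ennreal (S \<omega>)"
      using S_nonneg by (simp add: ennreal_mult sum_nonneg flip: sum_ennreal)
    finally show ?thesis .
  qed
  have "(\<lambda>\<omega>. ennreal ((specnorm (X k \<omega>))^2)) \<in> borel_measurable M" if "k \<in> {..<N}" for k
    using assms(2) that[unfolded lessThan_iff] by measurable
  moreover have "(\<lambda>\<omega>. ennreal (S \<omega>)) \<in> borel_measurable M"
    unfolding S_def using assms(3) by measurable
  ultimately have "(\<integral>\<^sup>+\<omega>. ennreal ((norm (\<Sum>k<N. F k *v (X k \<omega> *v y k \<omega>)))^2) \<partial>M)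
      \<le> (\<Sum>k<N. ennreal ((specnorm (F k))^2) * esqrt (\<integral>\<^sup>+\<omega>. (ennreal ((specnorm (X k \<omega>))^2))^2 \<partial>M))
        * esqrt (\<integral>\<^sup>+\<omega>. (ennreal (S \<omega>))^2 \<partial>M)"
    by (intro order_trans[OF nn_integral_mono[OF pointwise]] nn_integral_sum_mult_le_esqrt) auto
  then show ?thesis
    using S_nonneg by (simp add: S_def ennreal_power flip: power_mult)
qed

end
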